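(* Let $\mathcal M$ be a finite, finally connected and finally aperiodic Markov chain with an output function $k\colon\mathcal E\to\mathbb R$, and let $K_n$ be the corresponding output sum, with $\mathbb V(K_n)=vn+\mathcal O(1)$. The following assertions are equivalent: (a) The asymptotic variance $v$ of the output sum is $0$. (b) There exist a state $s$ of the final component and a constant $a\in\mathbb R$ such that $k(C)=a\,\mathbb{1}(C)$ holds for every closed walk $C$ of the final component visiting the state $s$ exactly once. (c) There exists a constant $a\in\mathbb R$ such that $k(C)=a\,\mathbb{1}(C)$ holds for every directed cycle $C$ of the final component of $\mathcal M$. In that case, the expected value of $K_n$ is $an+\mathcal O(1)$, and statement (b) holds for all states $s$ of the final component. If $\mathcal M$ is furthermore strongly connected, the following assertion is also equivalent to (a)–(c): (d) The random variable $K_n$ is quasi-deterministic with constant $a$, i.e. $K_n=an+\mathcal O(1)$ holds for all $n$.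
   Context: A finite Markov chain here consists of a finite state space $\{1,\dots,M\}$, a finite set $\mathcal E$ of transitions between states (multiple transitions between the same pair of states and loops allowed), each transition $e$ having a probability $p_e>0$ such that for every state $i$ the probabilities of the transitions starting in $i$ sum to $1$, and a unique initial state $1$. All states are accessible from state $1$. The chain is finally connected if the condensation of its underlying digraph (contract each strongly connected component) has exactly one vertex of out-degree $0$; the corresponding strongly connected component is the final component. It is finally aperiodic if the gcd of the lengths of all cycles of the final component is $1$. $X_n$ is a random path of length $n$ starting in state $1$, where a path $P$ has probability $\prod_{e\in P}p_e$. For an output function $k\colon\mathcal E\to\mathbb R$, the output sum $K_n$ is the sum of $k(e)$ over the transitions $e$ of $X_n$. For a closed walk or cycle $C$, $k(C)=\sum_{e\in C}k(e)$ (with multiplicity), and $\mathbb{1}$ denotes the constant function $\mathbb{1}(e)=1$, so $\mathbb{1}(C)$ is the length of $C$. The asymptotic variance $v$ is the constant with $\mathbb V(K_n)=vn+\mathcal O(1)$. *)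

theory Defs
  imports "HOL-Probability.Probability" "Graph_Theory.Graph_Theory" "HOL-Library.Landau_Symbols"
begin

locale finite_markov_chain = fin_digraph G for G :: "('a, 'b) pre_digraph" +
  fixes p :: "'b \<Rightarrow> real" and init :: 'a
  assumes init_in_verts: "init \<in> verts G"
    and prob_pos: "\<And>e. e \<in> arcs G \<Longrightarrow> p e > 0"
    and prob_sum: "\<And>i. i \<in> verts G \<Longrightarrow> (\<Sum>e\<in>out_arcs G i. p e) = 1"
    and accessible: "\<And>i. i \<in> verts G \<Longrightarrow> init \<rightarrow>\<^sup>*\<^bsub>G\<^esub> i"

text \<open>
  The condensation contracts every strongly connected component to one vertex. Transitions inside
  a component disappear, so the result is acyclic and in particular has no loops; parallel arcs are
  kept, which is immaterial for the question whether an out-degree is 0.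
\<close>

definition condensation :: "('a, 'b) pre_digraph \<Rightarrow> ('a set, 'b) pre_digraph" where
  "condensation G = \<lparr> verts = pre_digraph.sccs_verts G,
     arcs = {e \<in> arcs G. pre_digraph.scc_of G (tail G e) \<noteq> pre_digraph.scc_of G (head G e)},
     tail = (\<lambda>e. pre_digraph.scc_of G (tail G e)),
     head = (\<lambda>e. pre_digraph.scc_of G (head G e)) \<rparr>"

definition finally_connected :: "('a, 'b) pre_digraph \<Rightarrow> bool" where
  "finally_connected G \<longleftrightarrow>
     (\<exists>!S. S \<in> verts (condensation G) \<and> out_degree (condensation G) S = 0)"

definition final_component :: "('a, 'b) pre_digraph \<Rightarrow> ('a, 'b) pre_digraph" where
  "final_component G =
     G \<restriction> (THE S. S \<in> verts (condensation G) \<and> out_degree (condensation G) S = 0)"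

definition finally_aperiodic :: "('a, 'b) pre_digraph \<Rightarrow> bool" where
  "finally_aperiodic G \<longleftrightarrow> Gcd {length C |C. pre_digraph.cycle (final_component G) C} = 1"

text \<open>
  The random path of length \<open>n\<close> starting in \<open>init\<close>, represented by its list of transitions;
  the lemma \<open>pmf_random_path\<close> below shows that the weights are a probability mass function.
\<close>

definition random_path :: "('a, 'b) pre_digraph \<Rightarrow> ('b \<Rightarrow> real) \<Rightarrow> 'a \<Rightarrow> nat \<Rightarrow> 'b list pmf" where
  "random_path G p init n = embed_pmf (\<lambda>P.
     if (\<exists>t. pre_digraph.awalk G init P t) \<and> length P = n then \<Prod>e\<leftarrow>P. p e else 0)"

definition output_sum :: "('b \<Rightarrow> real) \<Rightarrow> 'b list \<Rightarrow> real" where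
  "output_sum k P = (\<Sum>e\<leftarrow>P. k e)"

text \<open>
  The last vertex of a closed walk repeats the first one, hence visits of \<open>s\<close> are counted along the
  tails of the arcs. The walk need not start in \<open>s\<close>.
\<close>

definition closed_walks_visiting_once :: "('a, 'b) pre_digraph \<Rightarrow> 'a \<Rightarrow> 'b list set" where
  "closed_walks_visiting_once G s =
     {C. wf_digraph.closed_w G C \<and> count_list (map (tail G) C) s = 1}"

text \<open>
  The implied constant is uniform in \<open>n\<close> and in all realisations of positive probability.
\<close>

definition quasi_deterministic :: "(nat \<Rightarrow> 'c pmf) \<Rightarrow> ('c \<Rightarrow> real) \<Rightarrow> real \<Rightarrow> bool" where
  "quasi_deterministic X K a \<longleftrightarrow>
     (\<exists>c. \<forall>n. \<forall>P\<in>set_pmf (X n). \<bar>K P - a * real n\<bar> \<le> c)"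

context finite_markov_chain
begin

definition walks_from :: "'a \<Rightarrow> nat \<Rightarrow> 'b list set" where
  "walks_from s n = {P. (\<exists>t. awalk s P t) \<and> length P = n}"

lemma finite_walks_from: "finite (walks_from s n)"
  by (rule finite_subset[OF _ finite_lists_length_eq[OF finite_arcs, of n]])
     (auto simp: walks_from_def awalk_def)

lemma walks_from_Suc:
  assumes "s \<in> verts G"
  shows "walks_from s (Suc n) =
    (\<lambda>(e, P). e # P) ` (SIGMA e:out_arcs G s. walks_from (head G e) n)"
proof (intro set_eqI iffI)
  fix Q assume "Q \<in> walks_from s (Suc n)"
  then obtain e P t where "Q = e # P" "length P = n" "awalk s (e # P) t"
    unfolding walks_from_def by (auto simp: length_Suc_conv)
  then show "Q \<in> (\<lambda>(e, P). e # P) ` (SIGMA e:out_arcs G s. walks_from (head G e) n)"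
    by (intro image_eqI[where x = "(e, P)"]) (auto simp: walks_from_def awalk_Cons_iff)
qed (use assms in \<open>auto simp: walks_from_def awalk_Cons_iff\<close>)

lemma sum_walks_from:
  "s \<in> verts G \<Longrightarrow> (\<Sum>P\<in>walks_from s n. \<Prod>e\<leftarrow>P. p e) = 1"
proof (induction n arbitrary: s)
  case 0
  then have "walks_from s 0 = {[]}"
    by (auto simp: walks_from_def awalk_Nil_iff)
  then show ?case by simp
next
  case (Suc n)
  have "(\<Sum>P\<in>walks_from s (Suc n). \<Prod>e\<leftarrow>P. p e)
      = (\<Sum>(e, P)\<in>(SIGMA e:out_arcs G s. walks_from (head G e) n). p e * (\<Prod>e\<leftarrow>P. p e))"
    unfolding walks_from_Suc[OF Suc.prems]
    by (subst sum.reindex) (auto simp: inj_on_def intro!: sum.cong)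
  also have "\<dots> = (\<Sum>e\<in>out_arcs G s. \<Sum>P\<in>walks_from (head G e) n. p e * (\<Prod>e\<leftarrow>P. p e))"
    by (subst sum.Sigma) (auto simp: finite_walks_from)
  also have "\<dots> = (\<Sum>e\<in>out_arcs G s. p e)"
    by (intro sum.cong refl) (simp add: Suc.IH flip: sum_distrib_left)
  finally show ?case using prob_sum[OF Suc.prems] by simp
qed

lemma prod_list_prob_pos: "set P \<subseteq> arcs G \<Longrightarrow> (\<Prod>e\<leftarrow>P. p e) > 0"
  by (induction P) (auto simp: prob_pos)

lemma pmf_random_path:
  "pmf (random_path G p init n) P =
     (if (\<exists>t. awalk init P t) \<and> length P = n then \<Prod>e\<leftarrow>P. p e else 0)"
proof -
  let ?f = "\<lambda>P. if (\<exists>t. awalk init P t) \<and> length P = n then \<Prod>e\<leftarrow>P. p e else 0"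
  have nonneg: "?f P \<ge> 0" for P
    using prod_list_prob_pos[of P] by (auto simp: awalk_def)
  have "(\<integral>\<^sup>+P. ennreal (?f P) \<partial>count_space UNIV) = (\<Sum>P\<in>walks_from init n. ennreal (?f P))"
    by (rule nn_integral_count_space') (auto simp: finite_walks_from, auto simp: walks_from_def)
  also have "\<dots> = ennreal (\<Sum>P\<in>walks_from init n. ?f P)"
    by (rule sum_ennreal) (rule nonneg)
  also have "(\<Sum>P\<in>walks_from init n. ?f P) = (\<Sum>P\<in>walks_from init n. \<Prod>e\<leftarrow>P. p e)"
    by (rule sum.cong) (auto simp: walks_from_def)
  also have "\<dots> = 1"
    by (rule sum_walks_from[OF init_in_verts])
  finally show ?thesis
    unfolding random_path_def by (subst pmf_embed_pmf) (use nonneg in simp_all)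
qed

lemma set_pmf_random_path:
  "set_pmf (random_path G p init n) = {P. (\<exists>t. awalk init P t) \<and> length P = n}"
proof -
  have "(\<Prod>e\<leftarrow>P. p e) \<noteq> 0" if "awalk init P t" for P t
    using prod_list_prob_pos[of P] that by (simp add: awalk_def)
  then show ?thesis
    unfolding set_pmf_eq pmf_random_path by auto
qed

end

end

theory Submission
  imports Defs
begin

text \<open>
  By linear algebra and the maximum principle, the Poisson equation of a finally connected chain is
  solvable for every function \<open>f\<close> on the transitions: there are a constant \<open>\<mu>\<close> and a function \<open>g\<close> on
  the states such that the increments \<open>f e - \<mu> + g (head e) - g (tail e)\<close> have mean zero at every state.
  For \<open>f = k\<close> this writes \<open>K\<^sub>n - \<mu> n\<close> as a martingale with increments \<open>m\<close> up to a bounded error, whence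
  \<open>E K\<^sub>n = \<mu> n + O(1)\<close>. For \<open>f = m\<^sup>2\<close> it shows that the second moment of the martingale is \<open>\<nu> n + O(1)\<close>,
  so \<open>v = 0\<close> iff \<open>\<nu> = 0\<close>, and by the maximum principle on the final component this holds iff \<open>m\<close>
  vanishes there. The latter means that \<open>k - \<mu>\<close> is a potential difference on the final component,
  which is what the conditions on closed walks and on cycles express.
\<close>

section \<open>Weights of closed walks\<close>

lemma output_sum_Nil [simp]: "output_sum w [] = 0"
  and output_sum_Cons [simp]: "output_sum w (e # P) = w e + output_sum w P"
  and output_sum_append [simp]: "output_sum w (P @ Q) = output_sum w P + output_sum w Q"
  by (simp_all add: output_sum_def)

text \<open>Turns the condition \<open>k(C) = a * length C\<close> into the vanishing of the weight
  \<open>k - a\<close>, so that the arguments on closed walks only deal with zero sums.\<close>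

lemma output_sum_shift:
  "output_sum (\<lambda>e. w e - a) P = output_sum w P - a * real (length P)"
  by (induction P) (auto simp: algebra_simps)

context wf_digraph
begin

text \<open>Induction on the length: a closed walk that is not a cycle repeats a vertex after its
  first arc. Cutting out the closed subwalk between two visits splits it into two shorter closed
  walks.\<close>

lemma closed_walk_sum_zero_if_cycles:
  assumes "\<And>C. cycle C \<Longrightarrow> output_sum w C = 0" and "awalk u C u"
  shows "output_sum w C = 0"
  using assms(2)
proof (induction "length C" arbitrary: u C rule: less_induct)
  case less
  show ?case
  proof (cases C)
    case (Cons e es)
    then have es: "awalk (head G e) es u" and e: "e \<in> arcs G" "tail G e = u"
      using less.prems by (auto simp: awalk_Cons_iff)
    show ?thesis
    proof (cases "distinct (awalk_verts (head G e) es)")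
      \<comment> \<open>The predicate \<open>cycle\<close> tests distinctness on the vertex list
        without its first entry, which is the vertex list of \<open>es\<close>.\<close>
      case True
      then have "cycle C"
        using less.prems Cons unfolding cycle_def by auto
      then show ?thesis by (rule assms(1))
    next
      case False
      then obtain q r s x where dec: "es = q @ r @ s" "0 < length r"
          "awalk (head G e) q x" "awalk x r x" "awalk x s u"
        using awalk_not_distinct_decomp[OF es] by blast
      have "awalk u (e # q @ s) u"
        using e awalk_appendI[OF dec(3,5)] by (simp add: awalk_Cons_iff)
      then have "output_sum w (e # q @ s) = 0"
        by (rule less.hyps[rotated]) (use dec Cons in simp)
      moreover have "output_sum w r = 0"
        by (rule less.hyps[OF _ dec(4)]) (use dec Cons in simp)
      ultimately show ?thesis using dec Cons by simp
    qed
  qed simp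
qed

text \<open>A nonempty closed walk based at \<open>s\<close> decomposes at its returns to
  \<open>s\<close> into closed walks that visit \<open>s\<close> once; each induction step splits at
  one such return.\<close>

lemma closed_walk_sum_zero_if_visiting_once:
  assumes "\<And>C. C \<in> closed_walks_visiting_once G s \<Longrightarrow> output_sum w C = 0" and "awalk s C s"
  shows "output_sum w C = 0"
  using assms(2)
proof (induction "length C" arbitrary: C rule: less_induct)
  case less
  show ?case
  proof (cases C)
    case (Cons e es)
    then have es: "awalk (head G e) es s" and e: "e \<in> arcs G" "tail G e = s"
      using less.prems by (auto simp: awalk_Cons_iff)
    show ?thesis
    proof (cases "s \<in> set (map (tail G) es)")
      case False
      then have "C \<in> closed_walks_visiting_once G s"
        using less.prems Cons e
        by (auto simp: closed_walks_visiting_once_def closed_w_def count_list_0_iff)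
      then show ?thesis by (rule assms(1))
    next
      case True
      then obtain q f r where dec: "es = q @ f # r" "tail G f = s"
        by (auto simp: in_set_conv_decomp)
      have "awalk (head G e) q s" "awalk s (f # r) s"
        using es dec by (auto simp: awalk_Cons_iff)
      then have "awalk s (e # q) s" "awalk s (f # r) s"
        using e by (auto simp: awalk_Cons_iff)
      then have "output_sum w (e # q) = 0" "output_sum w (f # r) = 0"
        using less.hyps[of "e # q"] less.hyps[of "f # r"] dec Cons by auto
      then show ?thesis using dec Cons by simp
    qed
  qed simp
qed

lemma awalk_sum_potential:
  assumes "\<And>e. e \<in> arcs G \<Longrightarrow> w e = h (head G e) - h (tail G e)" and "awalk u P v"
  shows "output_sum w P = h v - h u"
  using assms(2) by (induction P arbitrary: u) (auto simp: awalk_simps assms(1))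

text \<open>The potential at \<open>u\<close> is the weight of a chosen walk from \<open>s\<close>
  to \<open>u\<close>. The walks to \<open>head G e\<close> with and without final arc
  \<open>e\<close> are closed by the same return walk \<open>Q\<close>, so comparing the two zero
  sums isolates \<open>w e\<close>.\<close>

lemma potential_if_closed_walks:
  assumes "strongly_connected G" and "s \<in> verts G"
    and closed: "\<And>C. awalk s C s \<Longrightarrow> output_sum w C = 0"
  obtains h :: "'a \<Rightarrow> real" where "\<And>e. e \<in> arcs G \<Longrightarrow> w e = h (head G e) - h (tail G e)"
proof -
  have conn: "\<exists>P. awalk u P v" if "u \<in> verts G" "v \<in> verts G" for u v
    using assms(1) that by (auto simp: strongly_connected_def reachable_awalk)
  then obtain P where P: "\<And>u. u \<in> verts G \<Longrightarrow> awalk s (P u) u"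
    using \<open>s \<in> verts G\<close> by metis
  define h where "h u = output_sum w (P u)" for u
  have "w e = h (head G e) - h (tail G e)" if "e \<in> arcs G" for e
  proof -
    have ends: "tail G e \<in> verts G" "head G e \<in> verts G"
      using that by auto
    then obtain Q where Q: "awalk (head G e) Q s"
      using conn \<open>s \<in> verts G\<close> by blast
    have "awalk s (P (tail G e) @ e # Q) s"
      by (rule awalk_appendI[OF P]) (use that Q in \<open>auto simp: awalk_Cons_iff\<close>)
    moreover have "awalk s (P (head G e) @ Q) s"
      by (rule awalk_appendI[OF P[OF ends(2)] Q])
    ultimately show ?thesis
      using closed[of "P (tail G e) @ e # Q"] closed[of "P (head G e) @ Q"]
      by (simp add: h_def)
  qed
  then show thesis by (rule that)
qed

lemma potential_if_cycles:
  assumes "strongly_connected G"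
    and "\<And>C. cycle C \<Longrightarrow> output_sum k C = a * real (length C)"
  obtains h :: "'a \<Rightarrow> real" where "\<And>e. e \<in> arcs G \<Longrightarrow> k e - a = h (head G e) - h (tail G e)"
proof -
  obtain s where "s \<in> verts G"
    using assms(1) by (auto simp: strongly_connected_def)
  from potential_if_closed_walks[OF assms(1) this, of "\<lambda>e. k e - a"] that show thesis
    using closed_walk_sum_zero_if_cycles[of "\<lambda>e. k e - a"] assms(2)
    by (simp add: output_sum_shift) blast
qed

lemma potential_if_visiting_once:
  assumes "strongly_connected G" and "s \<in> verts G"
    and "\<And>C. C \<in> closed_walks_visiting_once G s \<Longrightarrow> output_sum k C = a * real (length C)"
  obtains h :: "'a \<Rightarrow> real" where "\<And>e. e \<in> arcs G \<Longrightarrow> k e - a = h (head G e) - h (tail G e)"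
proof -
  from potential_if_closed_walks[OF assms(1,2), of "\<lambda>e. k e - a"] that show thesis
    using closed_walk_sum_zero_if_visiting_once[of s "\<lambda>e. k e - a"] assms(3)
    by (simp add: output_sum_shift) blast
qed

lemma closed_walk_sum_if_potential:
  assumes "\<And>e. e \<in> arcs G \<Longrightarrow> k e - a = h (head G e) - h (tail G e)" and "awalk u C u"
  shows "output_sum k C = a * real (length C)"
  using awalk_sum_potential[of "\<lambda>e. k e - a", OF assms] by (simp add: output_sum_shift)

end

section \<open>Underdetermined linear systems\<close>

text \<open>Gaussian elimination: equation \<open>i\<close> is used to eliminate an unknown
  \<open>l\<close> with nonzero coefficient, which leaves one equation and one unknown less.\<close>

lemma underdetermined_homogeneous_system:
  fixes A :: "'i \<Rightarrow> 'j \<Rightarrow> 'c::field"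
  assumes "finite I" "finite J" "card I < card J"
  shows "\<exists>x. (\<exists>j\<in>J. x j \<noteq> 0) \<and> (\<forall>i\<in>I. (\<Sum>j\<in>J. A i j * x j) = 0)"
  using assms
proof (induction I arbitrary: A J rule: finite_induct)
  case empty
  then have "J \<noteq> {}" by auto
  then show ?case by (intro exI[of _ "\<lambda>_. 1"]) auto
next
  case (insert i I)
  show ?case
  proof (cases "\<forall>j\<in>J. A i j = 0")
    case True
    obtain x where "\<exists>j\<in>J. x j \<noteq> 0" "\<forall>i\<in>I. (\<Sum>j\<in>J. A i j * x j) = 0"
      using insert.IH[of J A] insert.prems insert.hyps by auto
    then show ?thesis using True by (intro exI[of _ x]) auto
  next
    case False
    then obtain l where l: "l \<in> J" "A i l \<noteq> 0" by blast
    define J' where "J' = J - {l}"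
    have J: "J = insert l J'" "l \<notin> J'" "finite J'"
      using l insert.prems by (auto simp: J'_def)
    have "card I < card J'"
      using insert.prems insert.hyps J by simp
    then obtain x where x: "\<exists>j\<in>J'. x j \<noteq> 0"
        "\<And>m. m \<in> I \<Longrightarrow> (\<Sum>j\<in>J'. (A m j - A m l * A i j / A i l) * x j) = 0"
      using insert.IH[of J' "\<lambda>m j. A m j - A m l * A i j / A i l"] J by blast
    define c where "c = (\<Sum>j\<in>J'. A i j * x j)"
    \<comment> \<open>The value at \<open>l\<close> is forced by equation \<open>i\<close>; the
      other entries, and with them nontriviality, come from the reduced system.\<close>
    define y where "y = x(l := - c / A i l)"
    have sum_y: "(\<Sum>j\<in>J. A m j * y j) = (\<Sum>j\<in>J'. A m j * x j) - A m l * c / A i l" for m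
    proof -
      have "(\<Sum>j\<in>J'. A m j * y j) = (\<Sum>j\<in>J'. A m j * x j)"
        using J by (intro sum.cong) (auto simp: y_def)
      then show ?thesis using J by (simp add: y_def)
    qed
    have "(\<Sum>j\<in>J. A m j * y j) = 0" if "m \<in> I" for m
    proof -
      have "(\<Sum>j\<in>J'. A m j * x j) - A m l * c / A i l
          = (\<Sum>j\<in>J'. (A m j - A m l * A i j / A i l) * x j)"
        by (simp add: c_def sum_subtractf left_diff_distrib sum_distrib_left sum_divide_distrib
              mult.assoc)
      then show ?thesis using x(2)[OF that] sum_y[of m] by simp
    qed
    moreover have "(\<Sum>j\<in>J. A i j * y j) = 0"
      using l by (simp add: sum_y c_def)
    moreover have "\<exists>j\<in>J. y j \<noteq> 0"
      using x(1) J by (auto simp: y_def)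
    ultimately show ?thesis by (intro exI[of _ y]) auto
  qed
qed

section \<open>The final component\<close>

locale finally_connected_chain = finite_markov_chain G p init
  for G :: "('a, 'b) pre_digraph" (structure) and p init +
  assumes fin_conn: "finally_connected G"
begin

definition final_verts :: "'a set" where
  "final_verts = (THE S. S \<in> verts (condensation G) \<and> out_degree (condensation G) S = 0)"

lemma final_component_eq: "final_component G = G \<restriction> final_verts"
  by (simp add: final_component_def final_verts_def)

lemma out_degree_condensation_eq_0_iff:
  "out_degree (condensation G) S = 0 \<longleftrightarrow>
     (\<forall>e\<in>arcs G. scc_of (tail G e) = S \<longrightarrow> scc_of (head G e) = S)"
proof -
  \<comment> \<open>The out-degree is a cardinality, which is also 0 for infinite sets; finiteness
    lets it express emptiness.\<close>
  have "finite (out_arcs (condensation G) S)"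
    by (rule finite_subset[OF _ finite_arcs]) (auto simp: condensation_def out_arcs_def)
  then show ?thesis
    by (auto simp: out_degree_def) (auto simp: condensation_def out_arcs_def)
qed

text \<open>Existence shows that the described set has the defining properties; uniqueness lets
  \<open>reaches_final_verts\<close> recognise a component without outgoing transitions as the final
  one.\<close>

lemma final_verts_eq_iff:
  "final_verts = S \<longleftrightarrow> S \<in> verts (condensation G) \<and> out_degree (condensation G) S = 0"
proof -
  let ?P = "\<lambda>S. S \<in> verts (condensation G) \<and> out_degree (condensation G) S = 0"
  have ex1: "\<exists>!S. ?P S"
    using fin_conn by (simp add: finally_connected_def)
  show ?thesis
    using theI'[OF ex1] the1_equality[OF ex1, of S] unfolding final_verts_def by metis
qed

lemma final_verts_in_sccs: "final_verts \<in> sccs_verts"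
  using final_verts_eq_iff[of final_verts] by (simp add: condensation_def)

lemma final_verts_subset: "final_verts \<subseteq> verts G"
  by (rule sccs_verts_subsets[OF final_verts_in_sccs])

lemma finite_final_verts: "finite final_verts"
  using final_verts_subset finite_verts by (rule finite_subset)

lemma final_verts_nonempty: "final_verts \<noteq> {}"
  using final_verts_in_sccs by (auto simp: in_sccs_verts_conv_reachable)

lemma reachable_in_final_verts:
  "u \<in> final_verts \<Longrightarrow> t \<in> final_verts \<Longrightarrow> u \<rightarrow>\<^sup>* t"
  using final_verts_in_sccs by (auto simp: in_sccs_verts_conv_reachable)

lemma scc_of_final: "u \<in> final_verts \<Longrightarrow> scc_of u = final_verts"
  using final_verts_in_sccs unfolding in_sccs_verts_conv_reachable scc_of_def by blast

lemma final_verts_closed: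
  assumes "e \<in> arcs G" "tail G e \<in> final_verts"
  shows "head G e \<in> final_verts"
proof -
  have "scc_of (head G e) = final_verts"
    using final_verts_eq_iff[of final_verts] assms scc_of_final
    by (auto simp: out_degree_condensation_eq_0_iff)
  then show ?thesis
    using in_scc_of_self[of "head G e"] assms by auto
qed

text \<open>
  A vertex reachable from \<open>u\<close> that itself reaches as few vertices as possible lies in a component
  without outgoing transitions.
\<close>

lemma reaches_final_verts:
  assumes "u \<in> verts G"
  shows "\<exists>t\<in>final_verts. u \<rightarrow>\<^sup>* t"
proof -
  define R where "R t = {x. t \<rightarrow>\<^sup>* x}" for t
  have fin: "finite (R t)" for t
    by (rule finite_subset[OF _ finite_verts]) (auto simp: R_def reachable_in_verts)
  obtain t where t: "u \<rightarrow>\<^sup>* t" and least: "\<And>x. u \<rightarrow>\<^sup>* x \<Longrightarrow> card (R t) \<le> card (R x)"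
    using arg_min_natI[of "\<lambda>x. u \<rightarrow>\<^sup>* x" u "\<lambda>x. card (R x)"]
      arg_min_nat_le[of "\<lambda>x. u \<rightarrow>\<^sup>* x" _ "\<lambda>x. card (R x)"] assms by blast
  have t_vert: "t \<in> verts G"
    using t by (rule reachable_in_verts)
  have returns: "x \<rightarrow>\<^sup>* t" if "t \<rightarrow>\<^sup>* x" for x
  proof -
    have "R x \<subseteq> R t"
      using that by (auto simp: R_def intro: reachable_trans)
    moreover have "card (R t) \<le> card (R x)"
      using t that by (intro least) (rule reachable_trans)
    ultimately have "R x = R t"
      using fin by (intro card_seteq) auto
    then show ?thesis using t_vert by (auto simp: R_def)
  qed
  have "out_degree (condensation G) (scc_of t) = 0"
    unfolding out_degree_condensation_eq_0_iff
  proof (intro ballI impI)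
    fix e assume e: "e \<in> arcs G" "scc_of (tail G e) = scc_of t"
    then have "t \<rightarrow>\<^sup>* tail G e"
      using in_scc_of_self[of "tail G e"] by (auto simp: scc_of_def)
    also have "tail G e \<rightarrow>\<^sup>* head G e"
      using e by (auto intro: in_arcs_imp_in_arcs_ends)
    finally have "head G e \<in> scc_of t"
      using returns by (auto simp: scc_of_def)
    then show "scc_of (head G e) = scc_of t" by (rule scc_of_eq)
  qed
  then have "final_verts = scc_of t"
    using scc_of_in_sccs_verts[OF t_vert] by (simp add: final_verts_eq_iff condensation_def)
  then show ?thesis
    using t in_scc_of_self[OF t_vert] by auto
qed

lemma wf_final_component: "wf_digraph (final_component G)"
  unfolding final_component_eq by (rule wellformed_induce_subgraph)

lemma verts_final_component: "verts (final_component G) = final_verts"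
  by (simp add: final_component_eq)

lemma arcs_final_component: "arcs (final_component G) = {e \<in> arcs G. tail G e \<in> final_verts}"
  using final_verts_closed by (auto simp: final_component_eq)

lemma strongly_connected_final_component: "strongly_connected (final_component G)"
  using final_verts_in_sccs
  by (auto simp: final_component_eq in_sccs_verts_conv elim: in_sccsE)

lemma final_component_if_strongly_connected:
  assumes "strongly_connected G"
  shows "final_component G = G"
proof -
  obtain s where s: "s \<in> final_verts" using final_verts_nonempty by blast
  have "t \<in> final_verts" if "s \<rightarrow>\<^sup>* t" for t
    using that s by (induction rule: reachable_induct) (auto intro: final_verts_closed)
  then have "final_verts = verts G"
    using assms s final_verts_subset by (auto simp: strongly_connected_def)
  moreover have "{e \<in> arcs G. tail G e \<in> verts G \<and> head G e \<in> verts G} = arcs G"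
    by auto
  ultimately show ?thesis
    by (simp add: final_component_eq induce_subgraph_def)
qed

section \<open>Maximum principle and Poisson equation\<close>

text \<open>The argument is a function on transitions, as the output is. On \<open>drift g\<close>
  this is the generator \<open>P - I\<close> of the chain applied to \<open>g\<close>, where
  \<open>P\<close> is the transition matrix; \<open>step_mean (drift g) u \<le> 0\<close> says that
  \<open>g\<close> is superharmonic at \<open>u\<close>.\<close>

definition step_mean :: "('b \<Rightarrow> real) \<Rightarrow> 'a \<Rightarrow> real" where
  "step_mean f u = (\<Sum>e\<in>out_arcs G u. p e * f e)"

abbreviation drift :: "('a \<Rightarrow> real) \<Rightarrow> 'b \<Rightarrow> real" where
  "drift g e \<equiv> g (head G e) - g (tail G e)"

lemma step_mean_add: "step_mean (\<lambda>e. f e + g e) u = step_mean f u + step_mean g u"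
  and step_mean_diff: "step_mean (\<lambda>e. f e - g e) u = step_mean f u - step_mean g u"
  and step_mean_cmult: "step_mean (\<lambda>e. c * f e) u = c * step_mean f u"
  and step_mean_uminus: "step_mean (\<lambda>e. - f e) u = - step_mean f u"
  by (simp_all add: step_mean_def algebra_simps sum.distrib sum_subtractf sum_distrib_left sum_negf)

lemma step_mean_const: "u \<in> verts G \<Longrightarrow> step_mean (\<lambda>_. c) u = c"
  using prob_sum[of u] by (simp add: step_mean_def flip: sum_distrib_right)

lemma step_mean_cong:
  "(\<And>e. e \<in> arcs G \<Longrightarrow> tail G e = u \<Longrightarrow> f e = g e) \<Longrightarrow> step_mean f u = step_mean g u"
  unfolding step_mean_def by (intro sum.cong) auto

lemma step_mean_mono:
  "(\<And>e. e \<in> arcs G \<Longrightarrow> tail G e = u \<Longrightarrow> f e \<le> g e) \<Longrightarrow> step_mean f u \<le> step_mean g u"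
  unfolding step_mean_def by (intro sum_mono mult_left_mono) (auto intro: less_imp_le prob_pos)

lemma step_mean_nonneg_eq_0:
  assumes "\<And>e. e \<in> arcs G \<Longrightarrow> tail G e = u \<Longrightarrow> 0 \<le> f e" and "step_mean f u \<le> 0"
    and "e \<in> arcs G" "tail G e = u"
  shows "f e = 0"
proof -
  have nonneg: "\<And>e. e \<in> out_arcs G u \<Longrightarrow> 0 \<le> p e * f e"
    using assms(1) by (auto intro!: mult_nonneg_nonneg less_imp_le[OF prob_pos])
  then have "step_mean f u = 0"
    using assms(2) sum_nonneg[of "out_arcs G u" "\<lambda>e. p e * f e"] by (simp add: step_mean_def)
  then have "p e * f e = 0"
    using nonneg assms(3,4) unfolding step_mean_def
    by (subst (asm) sum_nonneg_eq_0_iff) auto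
  then show ?thesis
    using prob_pos[OF assms(3)] by simp
qed

text \<open>At a minimum over the closed set \<open>S\<close> all drifts are nonnegative while their
  mean is at most 0. Since all probabilities are positive, every drift vanishes and the minimum
  passes to all successors.\<close>

lemma superharmonic_min_propagates:
  assumes "\<And>u. u \<in> S \<Longrightarrow> step_mean (drift g) u \<le> 0"
    and closed: "\<And>e. e \<in> arcs G \<Longrightarrow> tail G e \<in> S \<Longrightarrow> head G e \<in> S"
    and "s \<in> S" "\<And>u. u \<in> S \<Longrightarrow> g s \<le> g u" "s \<rightarrow>\<^sup>* t"
  shows "t \<in> S \<and> g t = g s"
  using \<open>s \<rightarrow>\<^sup>* t\<close>
proof (induction rule: reachable_induct)
  case (step x y)
  then obtain e where e: "e \<in> arcs G" "tail G e = x" "head G e = y"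
    by auto
  have "drift g e = 0"
    by (rule step_mean_nonneg_eq_0[where u = x]) (use e step assms in auto)
  then show ?case using e step closed by auto
qed (use assms in auto)

lemma superharmonic_const_on_final:
  assumes "\<And>u. u \<in> final_verts \<Longrightarrow> step_mean (drift g) u \<le> 0"
    and "u \<in> final_verts" "t \<in> final_verts"
  shows "g u = g t"
proof -
  obtain s where s: "s \<in> final_verts" "\<And>u. u \<in> final_verts \<Longrightarrow> g s \<le> g u"
    using ex_is_arg_min_if_finite[OF finite_final_verts final_verts_nonempty, of g]
    by (auto simp: is_arg_min_linorder)
  have "g x = g s" if "x \<in> final_verts" for x
    using superharmonic_min_propagates[of final_verts g s x] assms(1) s that
      final_verts_closed reachable_in_final_verts by blast
  then show ?thesis using assms by simp
qed

text \<open>According to the sign of \<open>c\<close>, either \<open>g\<close> or \<open>- g\<close>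
  is superharmonic, so \<open>g\<close> is constant on the final component. All drifts there vanish,
  and so does their mean \<open>c\<close>.\<close>

lemma constant_drift_on_final:
  assumes "\<And>u. u \<in> final_verts \<Longrightarrow> step_mean (drift g) u = c"
  shows "c = 0" and "u \<in> final_verts \<Longrightarrow> t \<in> final_verts \<Longrightarrow> g u = g t"
proof -
  have const: "g u = g t" if "u \<in> final_verts" "t \<in> final_verts" for u t
  proof (cases "c \<le> 0")
    case True
    show ?thesis
      by (rule superharmonic_const_on_final[OF _ that]) (use assms True in simp)
  next
    case False
    have "step_mean (drift (\<lambda>x. - g x)) x \<le> 0" if "x \<in> final_verts" for x
      using assms[OF that] step_mean_uminus[of "drift g" x] False by simp
    then have "- g u = - g t"
      by (rule superharmonic_const_on_final[OF _ that])
    then show ?thesis by simp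
  qed
  show "g u = g t" if "u \<in> final_verts" "t \<in> final_verts"
    using that by (rule const)
  obtain s where s: "s \<in> final_verts" using final_verts_nonempty by blast
  have "drift g e = 0" if "e \<in> arcs G" "tail G e = s" for e
    using const[of "head G e" "tail G e"] final_verts_closed[of e] that s by simp
  then have "step_mean (drift g) s = step_mean (\<lambda>_. 0) s"
    by (rule step_mean_cong)
  then show "c = 0"
    using assms[OF s] by (simp add: step_mean_def)
qed

text \<open>A global minimum propagates along a path into the final component, on which
  \<open>g\<close> is constant.\<close>

lemma superharmonic_min_on_final:
  assumes "\<And>u. u \<in> verts G \<Longrightarrow> step_mean (drift g) u \<le> 0"
    and "u \<in> final_verts" "t \<in> verts G"
  shows "g u \<le> g t"
proof -
  obtain s where s: "s \<in> verts G" "\<And>u. u \<in> verts G \<Longrightarrow> g s \<le> g u"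
    using ex_is_arg_min_if_finite[OF finite_verts, of g] assms(3)
    by (auto simp: is_arg_min_linorder)
  obtain x where x: "x \<in> final_verts" "s \<rightarrow>\<^sup>* x"
    using reaches_final_verts[OF s(1)] by blast
  have "g x = g s"
    using superharmonic_min_propagates[of "verts G" g s x] assms(1) s x head_in_verts by blast
  moreover have "g u = g x"
    by (rule superharmonic_const_on_final) (use assms final_verts_subset x in blast)+
  ultimately show ?thesis using s assms by simp
qed

text \<open>This determines the kernel of the Poisson equation. Once \<open>c = 0\<close>, both
  \<open>g\<close> and \<open>- g\<close> are superharmonic on all states, so the value on the final
  component is both the minimum and the maximum.\<close>

lemma constant_drift:
  assumes "\<And>u. u \<in> verts G \<Longrightarrow> step_mean (drift g) u = c"
    and "u \<in> verts G" "t \<in> verts G"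
  shows "c = 0" and "g u = g t"
proof -
  show c: "c = 0"
    by (rule constant_drift_on_final(1)[of g]) (use assms(1) final_verts_subset in blast)
  have neg: "step_mean (drift (\<lambda>x. - g x)) x \<le> 0" if "x \<in> verts G" for x
    using assms(1)[OF that] step_mean_uminus[of "drift g" x] c by simp
  obtain s where s: "s \<in> final_verts" using final_verts_nonempty by blast
  have "g x = g s" if "x \<in> verts G" for x
  proof (rule antisym)
    show "g s \<le> g x"
      by (rule superharmonic_min_on_final[OF _ s that]) (simp add: assms(1) c)
    have "- g s \<le> - g x"
      by (rule superharmonic_min_on_final[OF neg s that])
    then show "g x \<le> g s" by simp
  qed
  then show "g u = g t" using assms by simp
qed

text \<open>
  The unknowns are \<open>\<mu>\<close>, the values of \<open>g\<close> outside \<open>init\<close> (where \<open>g\<close> is normalised to 0), and a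
  coefficient of the right-hand side \<open>f\<close>: one more than there are equations. The coefficient of \<open>f\<close>
  in a nontrivial solution does not vanish by the maximum principle.
\<close>

lemma poisson_equation:
  obtains g \<mu> where "\<And>u. u \<in> verts G \<Longrightarrow> step_mean (\<lambda>e. f e - \<mu> + drift g e) u = 0"
proof -
  \<comment> \<open>The index \<open>None\<close> carries the coefficient of \<open>f\<close>. The
    index \<open>Some init\<close>, free because \<open>g\<close> is normalised to 0 at
    \<open>init\<close>, carries the unknown \<mu>, whose coefficient is \<open>- 1\<close>.\<close>
  define A where "A u j = (case j of None \<Rightarrow> step_mean f u
    | Some y \<Rightarrow> if y = init then - 1 else step_mean (drift (\<lambda>z. of_bool (z = y))) u)" for u j
  define J where "J = insert None (Some ` verts G)"
  have "card (verts G) < card J"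
    by (simp add: J_def card_image)
  then obtain x where x: "\<exists>j\<in>J. x j \<noteq> 0"
      "\<And>u. u \<in> verts G \<Longrightarrow> (\<Sum>j\<in>J. A u j * x j) = 0"
    using underdetermined_homogeneous_system[of "verts G" J A] by (auto simp: J_def)
  define g where "g u = (if u = init then 0 else x (Some u))" for u
  have eq: "step_mean f u * x None - x (Some init) + step_mean (drift g) u = 0"
    if u: "u \<in> verts G" for u
  proof -
    have g_expand: "g z = (\<Sum>y\<in>verts G. g y * of_bool (z = y))" if "z \<in> verts G" for z
      using that by (simp add: of_bool_def if_distrib cong: if_cong)
    have "step_mean (drift g) u
        = step_mean (\<lambda>e. \<Sum>y\<in>verts G. g y * drift (\<lambda>z. of_bool (z = y)) e) u"
      by (rule step_mean_cong)
         (subst (1 2) g_expand, auto simp: sum_subtractf right_diff_distrib)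
    also have "\<dots> = (\<Sum>y\<in>verts G. g y * step_mean (drift (\<lambda>z. of_bool (z = y))) u)"
      unfolding step_mean_def sum_distrib_left by (subst sum.swap) (simp add: mult_ac)
    also have "\<dots> = (\<Sum>y\<in>verts G - {init}. g y * step_mean (drift (\<lambda>z. of_bool (z = y))) u)"
      by (rule sum.mono_neutral_right) (auto simp: g_def)
    also have "\<dots> = (\<Sum>y\<in>verts G - {init}. A u (Some y) * x (Some y))"
      by (rule sum.cong) (auto simp: g_def A_def)
    finally have "step_mean (drift g) u = (\<Sum>y\<in>verts G. A u (Some y) * x (Some y)) + x (Some init)"
      using sum.remove[OF finite_verts init_in_verts, of "\<lambda>y. A u (Some y) * x (Some y)"]
      by (simp add: A_def)
    moreover have "(\<Sum>j\<in>J. A u j * x j)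
        = step_mean f u * x None + (\<Sum>y\<in>verts G. A u (Some y) * x (Some y))"
      by (simp add: J_def A_def sum.reindex)
    ultimately show ?thesis using x(2)[OF u] by simp
  qed
  have nz: "x None \<noteq> 0"
  proof
    assume x0: "x None = 0"
    \<comment> \<open>Without the term of \<open>f\<close> the equations say that \<open>g\<close>
      has constant mean drift, so the solution would be trivial.\<close>
    have drift: "step_mean (drift g) u = x (Some init)" if "u \<in> verts G" for u
      using eq[OF that] x0 by simp
    have "x (Some init) = 0"
      using constant_drift(1)[OF drift init_in_verts init_in_verts] .
    moreover have "g u = 0" if "u \<in> verts G" for u
      using constant_drift(2)[OF drift that init_in_verts] by (simp add: g_def)
    ultimately have "x (Some u) = 0" if "u \<in> verts G" for u
      using that by (metis g_def)
    then show False using x(1) x0 by (auto simp: J_def)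
  qed
  show thesis
  proof
    fix u assume u: "u \<in> verts G"
    have "step_mean (\<lambda>e. f e - x (Some init) / x None + drift (\<lambda>z. g z / x None) e) u
        = step_mean f u - x (Some init) / x None + step_mean (drift g) u / x None"
      using step_mean_cmult[of "1 / x None" "drift g" u] u
      by (simp add: step_mean_add step_mean_diff step_mean_const diff_divide_distrib)
    also have "\<dots> = (step_mean f u * x None - x (Some init) + step_mean (drift g) u) / x None"
      using nz by (simp add: field_simps)
    finally show "step_mean (\<lambda>e. f e - x (Some init) / x None + drift (\<lambda>z. g z / x None) e) u = 0"
      using eq[OF u] by simp
  qed
qed

section \<open>Moments of the output sum\<close>

text \<open>The expectation over random walks with arbitrary start \<open>s\<close>, so that
  inductions can condition on the first transition.\<close>

definition walk_mean :: "nat \<Rightarrow> 'a \<Rightarrow> ('b list \<Rightarrow> real) \<Rightarrow> real" where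
  "walk_mean n s f = (\<Sum>P\<in>walks_from s n. (\<Prod>e\<leftarrow>P. p e) * f P)"

lemma expectation_random_path:
  "measure_pmf.expectation (random_path G p init n) f = walk_mean n init f"
proof -
  have "measure_pmf.expectation (random_path G p init n) f
      = (\<Sum>P\<in>walks_from init n. f P * pmf (random_path G p init n) P)"
    by (rule integral_measure_pmf_real) (auto simp: finite_walks_from set_pmf_random_path, auto simp: walks_from_def)
  also have "\<dots> = walk_mean n init f"
    unfolding walk_mean_def by (rule sum.cong) (auto simp: pmf_random_path walks_from_def)
  finally show ?thesis .
qed

lemma walk_mean_0: "s \<in> verts G \<Longrightarrow> walk_mean 0 s f = f []"
proof -
  assume "s \<in> verts G"
  then have "walks_from s 0 = {[]}"
    by (auto simp: walks_from_def awalk_Nil_iff)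
  then show ?thesis by (simp add: walk_mean_def)
qed

lemma walk_mean_Suc:
  assumes "s \<in> verts G"
  shows "walk_mean (Suc n) s f = step_mean (\<lambda>e. walk_mean n (head G e) (\<lambda>P. f (e # P))) s"
proof -
  have "walk_mean (Suc n) s f
      = (\<Sum>(e, P)\<in>(SIGMA e:out_arcs G s. walks_from (head G e) n).
           p e * ((\<Prod>e\<leftarrow>P. p e) * f (e # P)))"
    unfolding walk_mean_def walks_from_Suc[OF assms]
    by (subst sum.reindex) (auto simp: inj_on_def mult.assoc intro!: sum.cong)
  also have "\<dots> = (\<Sum>e\<in>out_arcs G s. \<Sum>P\<in>walks_from (head G e) n.
      p e * ((\<Prod>e\<leftarrow>P. p e) * f (e # P)))"
    by (subst sum.Sigma) (auto simp: finite_walks_from)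
  finally show ?thesis
    by (simp add: step_mean_def walk_mean_def sum_distrib_left)
qed

lemma walk_mean_add: "walk_mean n s (\<lambda>P. f P + g P) = walk_mean n s f + walk_mean n s g"
  and walk_mean_diff: "walk_mean n s (\<lambda>P. f P - g P) = walk_mean n s f - walk_mean n s g"
  and walk_mean_cmult: "walk_mean n s (\<lambda>P. c * f P) = c * walk_mean n s f"
  by (simp_all add: walk_mean_def algebra_simps sum.distrib sum_subtractf sum_distrib_left)

lemma walk_mean_const: "s \<in> verts G \<Longrightarrow> walk_mean n s (\<lambda>_. c) = c"
  using sum_walks_from[of s n] by (simp add: walk_mean_def flip: sum_distrib_right)

lemma walk_mean_mono:
  assumes "\<And>P. P \<in> walks_from s n \<Longrightarrow> f P \<le> g P"
  shows "walk_mean n s f \<le> walk_mean n s g"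
  unfolding walk_mean_def
proof (intro sum_mono mult_left_mono assms)
  fix P assume "P \<in> walks_from s n"
  then show "0 \<le> (\<Prod>e\<leftarrow>P. p e)"
    by (intro less_imp_le[OF prod_list_prob_pos]) (auto simp: walks_from_def awalk_def)
qed

lemma walk_mean_abs_le:
  assumes "s \<in> verts G" "\<And>P. P \<in> walks_from s n \<Longrightarrow> \<bar>f P\<bar> \<le> c"
  shows "\<bar>walk_mean n s f\<bar> \<le> c"
proof -
  have bound: "f P \<le> c" "- c \<le> f P" if "P \<in> walks_from s n" for P
    using assms(2)[OF that] by linarith+
  show ?thesis
    using walk_mean_mono[of s n f "\<lambda>_. c", OF bound(1)]
      walk_mean_mono[of s n "\<lambda>_. - c" f, OF bound(2)]
    by (simp add: walk_mean_const[OF assms(1)])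
qed

lemma walk_mean_centred:
  assumes "\<And>u. u \<in> verts G \<Longrightarrow> step_mean m u = 0" and "s \<in> verts G"
  shows "walk_mean n s (output_sum m) = 0"
  using assms(2)
proof (induction n arbitrary: s)
  case (Suc n)
  have "walk_mean (Suc n) s (output_sum m) = step_mean m s"
    unfolding walk_mean_Suc[OF Suc.prems]
    by (rule step_mean_cong) (simp add: walk_mean_add walk_mean_const Suc.IH)
  then show ?case using assms(1)[OF Suc.prems] by simp
qed (simp add: walk_mean_0)

text \<open>The expression inside the absolute value, as a function of the start state, is averaged
  over one step when \<open>n\<close> increases by 1: the Poisson equation for the squared
  increments absorbs everything else. Averaging preserves the bound \<open>B\<close>, which holds at
  \<open>n = 0\<close>, where the expression is \<open>- g s\<close>.\<close>

lemma second_moment_centred: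
  assumes "\<And>u. u \<in> verts G \<Longrightarrow> step_mean m u = 0"
    and "\<And>u. u \<in> verts G \<Longrightarrow> step_mean (\<lambda>e. (m e)\<^sup>2 - \<nu> + drift g e) u = 0"
    and "\<And>u. u \<in> verts G \<Longrightarrow> \<bar>g u\<bar> \<le> B" and "s \<in> verts G"
  shows "\<bar>walk_mean n s (\<lambda>P. (output_sum m P)\<^sup>2) - \<nu> * real n - g s\<bar> \<le> B"
  using assms(4)
proof (induction n arbitrary: s)
  case 0
  then show ?case using assms(3) by (simp add: walk_mean_0)
next
  case (Suc n)
  define D where "D u = walk_mean n u (\<lambda>P. (output_sum m P)\<^sup>2) - \<nu> * real n - g u" for u
  have "walk_mean n (head G e) (\<lambda>P. (output_sum m (e # P))\<^sup>2)
      = ((m e)\<^sup>2 - \<nu> + drift g e) + (D (head G e) + (\<nu> * real (Suc n) + g s))"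
    if "e \<in> arcs G" "tail G e = s" for e
  proof -
    have "walk_mean n (head G e) (\<lambda>P. (output_sum m (e # P))\<^sup>2)
        = walk_mean n (head G e) (\<lambda>P. (m e)\<^sup>2 + 2 * m e * output_sum m P + (output_sum m P)\<^sup>2)"
      by (simp add: power2_sum algebra_simps)
    \<comment> \<open>The mixed term disappears because the remaining walk is centred from every
      start state.\<close>
    also have "\<dots> = (m e)\<^sup>2 + walk_mean n (head G e) (\<lambda>P. (output_sum m P)\<^sup>2)"
      using that walk_mean_centred[OF assms(1), of "head G e" n]
      by (simp add: walk_mean_add walk_mean_cmult walk_mean_const)
    finally show ?thesis
      using that by (simp add: D_def algebra_simps)
  qed
  then have "walk_mean (Suc n) s (\<lambda>P. (output_sum m P)\<^sup>2)
      = step_mean (\<lambda>e. ((m e)\<^sup>2 - \<nu> + drift g e) + (D (head G e) + (\<nu> * real (Suc n) + g s))) s"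
    unfolding walk_mean_Suc[OF Suc.prems] by (rule step_mean_cong)
  also have "\<dots> = step_mean (\<lambda>e. (m e)\<^sup>2 - \<nu> + drift g e) s
      + (step_mean (\<lambda>e. D (head G e)) s + (\<nu> * real (Suc n) + g s))"
    by (simp only: step_mean_add step_mean_const[OF Suc.prems])
  finally have eq: "walk_mean (Suc n) s (\<lambda>P. (output_sum m P)\<^sup>2) - \<nu> * real (Suc n) - g s
      = step_mean (\<lambda>e. D (head G e)) s"
    using assms(2)[OF Suc.prems] by simp
  have "\<bar>D (head G e)\<bar> \<le> B" if "e \<in> arcs G" for e
    using Suc.IH[of "head G e"] that by (simp add: D_def)
  then have "step_mean (\<lambda>_. - B) s \<le> step_mean (\<lambda>e. D (head G e)) s"
      "step_mean (\<lambda>e. D (head G e)) s \<le> step_mean (\<lambda>_. B) s"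
    by (intro step_mean_mono; fastforce simp: abs_le_iff)+
  then show ?case
    unfolding eq by (simp add: step_mean_const[OF Suc.prems] abs_le_iff)
qed

section \<open>Vanishing variance and potentials on the final component\<close>

lemma bounded_on_verts:
  obtains B where "\<And>u. u \<in> verts G \<Longrightarrow> \<bar>g u :: real\<bar> \<le> B"
proof
  show "\<bar>g u\<bar> \<le> (\<Sum>x\<in>verts G. \<bar>g x\<bar>)" if "u \<in> verts G" for u
    using that by (intro member_le_sum) auto
qed

text \<open>Adding the potential \<open>h\<close> to the Poisson solution \<open>g\<close> cancels
  \<open>k\<close>: the mean drift of \<open>h + g\<close> is the constant \<open>\<mu> - a\<close>.
  Hence this constant is 0 and \<open>h + g\<close> is constant on the final component.\<close>

lemma final_potential_unique:
  fixes \<mu> :: real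
  assumes poisson: "\<And>u. u \<in> verts G \<Longrightarrow> step_mean (\<lambda>e. k e - \<mu> + drift g e) u = 0"
    and potential: "\<And>e. e \<in> arcs G \<Longrightarrow> tail G e \<in> final_verts \<Longrightarrow> k e - a = drift h e"
  shows "a = \<mu>"
    and "e \<in> arcs G \<Longrightarrow> tail G e \<in> final_verts \<Longrightarrow> k e - \<mu> + drift g e = 0"
proof -
  have drift: "step_mean (drift (\<lambda>u. h u + g u)) u = \<mu> - a" if "u \<in> final_verts" for u
  proof -
    have "step_mean (drift (\<lambda>u. h u + g u)) u
        = step_mean (\<lambda>e. (k e - \<mu> + drift g e) + (\<mu> - a)) u"
    proof (rule step_mean_cong)
      fix e assume "e \<in> arcs G" "tail G e = u"
      then show "drift (\<lambda>u. h u + g u) e = (k e - \<mu> + drift g e) + (\<mu> - a)"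
        using potential[of e] that by simp
    qed
    also have "\<dots> = \<mu> - a"
      using that final_verts_subset poisson[of u]
      by (subst step_mean_add) (auto simp: step_mean_const)
    finally show ?thesis .
  qed
  show a: "a = \<mu>"
    using constant_drift_on_final(1)[OF drift] by simp
  show "k e - \<mu> + drift g e = 0" if "e \<in> arcs G" "tail G e \<in> final_verts"
    using constant_drift_on_final(2)[OF drift, of "head G e" "tail G e"] potential[of e]
      final_verts_closed[of e] that a by simp
qed

text \<open>The mean drift of \<open>g\<close> is \<nu> minus the mean of the squared increments.
  For \<open>\<nu> = 0\<close> this makes \<open>g\<close> superharmonic, hence constant, on the
  final component, so the squares have mean 0; if they vanish there, \<nu> is a constant mean
  drift.\<close>

lemma second_moment_rate_eq_0_iff:
  assumes "\<And>u. u \<in> verts G \<Longrightarrow> step_mean (\<lambda>e. (m e)\<^sup>2 - \<nu> + drift g e) u = 0"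
  shows "\<nu> = 0 \<longleftrightarrow> (\<forall>e\<in>arcs G. tail G e \<in> final_verts \<longrightarrow> m e = 0)"
proof -
  have drift: "step_mean (drift g) u = \<nu> - step_mean (\<lambda>e. (m e)\<^sup>2) u" if "u \<in> final_verts" for u
  proof -
    have u: "u \<in> verts G"
      using that final_verts_subset by blast
    show ?thesis
      using assms[OF u] step_mean_add[of "\<lambda>e. (m e)\<^sup>2 - \<nu>" "drift g" u]
        step_mean_diff[of "\<lambda>e. (m e)\<^sup>2" "\<lambda>_. \<nu>" u] step_mean_const[OF u, of \<nu>]
      by linarith
  qed
  show ?thesis
  proof
    assume "\<nu> = 0"
    have sq_nonneg: "0 \<le> step_mean (\<lambda>e. (m e)\<^sup>2) u" for u
      unfolding step_mean_def by (auto intro!: sum_nonneg mult_nonneg_nonneg less_imp_le[OF prob_pos])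
    have const: "g u = g t" if "u \<in> final_verts" "t \<in> final_verts" for u t
      by (rule superharmonic_const_on_final[OF _ that])
         (use drift sq_nonneg \<open>\<nu> = 0\<close> in simp)
    show "\<forall>e\<in>arcs G. tail G e \<in> final_verts \<longrightarrow> m e = 0"
    proof (intro ballI impI)
      fix e assume e: "e \<in> arcs G" "tail G e \<in> final_verts"
      have "drift g e' = 0" if "e' \<in> arcs G" "tail G e' = tail G e" for e'
        using const[of "head G e'" "tail G e'"] final_verts_closed[of e'] that e by simp
      then have "step_mean (drift g) (tail G e) = step_mean (\<lambda>_. 0) (tail G e)"
        by (rule step_mean_cong)
      then have "step_mean (\<lambda>e. (m e)\<^sup>2) (tail G e) = 0"
        using drift[OF e(2)] \<open>\<nu> = 0\<close> by (simp add: step_mean_def)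
      then have "(m e)\<^sup>2 = 0"
        by (intro step_mean_nonneg_eq_0[of "tail G e" "\<lambda>e. (m e)\<^sup>2"]) (use e in auto)
      then show "m e = 0" by simp
    qed
  next
    assume zero: "\<forall>e\<in>arcs G. tail G e \<in> final_verts \<longrightarrow> m e = 0"
    have "step_mean (drift g) u = \<nu>" if "u \<in> final_verts" for u
    proof -
      have "step_mean (\<lambda>e. (m e)\<^sup>2) u = step_mean (\<lambda>_. 0) u"
        using that zero by (intro step_mean_cong) auto
      then show ?thesis using drift[OF that] by (simp add: step_mean_def)
    qed
    then show "\<nu> = 0" by (rule constant_drift_on_final(1))
  qed
qed

text \<open>The variance and the second moment of the martingale bound each other up to the factor 2
  and an additive constant. This suffices to decide whether their linear rates vanish.\<close>

lemma output_rate: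
  assumes "(\<lambda>n. measure_pmf.variance (random_path G p init n) (output_sum k) - v * real n) \<in> O(\<lambda>_. 1)"
  obtains \<mu> where
    "(\<lambda>n. measure_pmf.expectation (random_path G p init n) (output_sum k) - \<mu> * real n) \<in> O(\<lambda>_. 1)"
    and "\<And>a h. (\<And>e. e \<in> arcs G \<Longrightarrow> tail G e \<in> final_verts \<Longrightarrow> k e - a = drift h e)
           \<Longrightarrow> a = \<mu> \<and> v = 0"
    and "v = 0 \<Longrightarrow>
      \<exists>h. \<forall>e\<in>arcs G. tail G e \<in> final_verts \<longrightarrow> k e - \<mu> = drift h e"
proof -
  obtain g \<mu> where g: "\<And>u. u \<in> verts G \<Longrightarrow> step_mean (\<lambda>e. k e - \<mu> + drift g e) u = 0"
    using poisson_equation[of k] by blast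
  define m where "m e = k e - \<mu> + drift g e" for e
  have m: "step_mean m u = 0" if "u \<in> verts G" for u
    using g[OF that] by (simp add: m_def[abs_def])
  obtain g' \<nu> where g': "\<And>u. u \<in> verts G \<Longrightarrow> step_mean (\<lambda>e. (m e)\<^sup>2 - \<nu> + drift g' e) u = 0"
    using poisson_equation[of "\<lambda>e. (m e)\<^sup>2"] by blast
  obtain B where B: "\<And>u. u \<in> verts G \<Longrightarrow> \<bar>g u\<bar> \<le> B" using bounded_on_verts by blast
  obtain B' where B': "\<And>u. u \<in> verts G \<Longrightarrow> \<bar>g' u\<bar> \<le> B'" using bounded_on_verts by blast

  define K where "K n = walk_mean n init (output_sum k)" for n
  define V where "V n = walk_mean n init (\<lambda>P. (output_sum k P - K n)\<^sup>2)" for n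
  define W where "W n = walk_mean n init (\<lambda>P. (output_sum m P)\<^sup>2)" for n
  have close: "\<bar>output_sum k P - \<mu> * real n - output_sum m P\<bar> \<le> 2 * B"
    if P: "P \<in> walks_from init n" for n P
  proof -
    obtain t where t: "awalk init P t" "length P = n"
      using P by (auto simp: walks_from_def)
    have "output_sum (\<lambda>e. m e - (k e - \<mu>)) P = g t - g init"
      by (rule awalk_sum_potential[OF _ t(1)]) (simp add: m_def)
    moreover have "output_sum (\<lambda>e. m e - (k e - \<mu>)) P = output_sum m P - output_sum (\<lambda>e. k e - \<mu>) P"
      by (induction P) auto
    ultimately have "output_sum k P - \<mu> * real n - output_sum m P = g init - g t"
      using t(2) by (simp add: output_sum_shift)
    then show ?thesis
      using B[of t] B[OF init_in_verts] awalk_last_in_verts[OF t(1)] by linarith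
  qed
  have K: "\<bar>K n - \<mu> * real n\<bar> \<le> 2 * B" for n
  proof -
    have "K n - \<mu> * real n = walk_mean n init (\<lambda>P. output_sum k P - \<mu> * real n - output_sum m P)"
      using walk_mean_centred[OF m init_in_verts, of n]
      by (simp add: walk_mean_diff walk_mean_const[OF init_in_verts] K_def)
    then show ?thesis
      using walk_mean_abs_le[OF init_in_verts close] by simp
  qed
  \<comment> \<open>The distance \<open>4 * B\<close> consists of \<open>2 * B\<close> for replacing
    the output sum by the martingale and \<open>2 * B\<close> for replacing its mean by
    \<open>\<mu> * n\<close>.\<close>
  define c where "c = 2 * (4 * B)\<^sup>2"
  have diff: "\<bar>(output_sum k P - K n) - output_sum m P\<bar> \<le> 4 * B" if "P \<in> walks_from init n" for n P
    using close[OF that] K[of n] by linarith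
  have sq_le: "x\<^sup>2 \<le> 2 * y\<^sup>2 + c" if "\<bar>x - y\<bar> \<le> 4 * B" for x y
  proof -
    have "(x - y)\<^sup>2 \<le> (4 * B)\<^sup>2"
      using that by (rule power2_le_iff_abs_le[THEN iffD2, rotated]) (use that in linarith)
    \<comment> \<open>The difference of the two sides is the square of
      \<open>x - 2 * y\<close>.\<close>
    moreover have "x\<^sup>2 \<le> 2 * y\<^sup>2 + 2 * (x - y)\<^sup>2"
      using zero_le_power2[of "x - 2 * y"] by (simp add: power2_eq_square algebra_simps)
    ultimately show ?thesis by (simp add: c_def)
  qed
  have V_le: "V n \<le> 2 * W n + c" for n
  proof -
    have "V n \<le> walk_mean n init (\<lambda>P. 2 * (output_sum m P)\<^sup>2 + c)"
      unfolding V_def by (rule walk_mean_mono) (rule sq_le[OF diff])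
    then show ?thesis
      by (simp add: walk_mean_add walk_mean_cmult walk_mean_const[OF init_in_verts] W_def)
  qed
  have W_le: "W n \<le> 2 * V n + c" for n
  proof -
    have "W n \<le> walk_mean n init (\<lambda>P. 2 * (output_sum k P - K n)\<^sup>2 + c)"
      unfolding W_def by (rule walk_mean_mono, rule sq_le) (use diff in \<open>simp add: abs_minus_commute\<close>)
    then show ?thesis
      by (simp add: walk_mean_add walk_mean_cmult walk_mean_const[OF init_in_verts] V_def)
  qed
  have nonneg: "0 \<le> V n" "0 \<le> W n" for n
    unfolding V_def W_def using walk_mean_mono[of init n "\<lambda>_. 0"]
    by (simp_all add: walk_mean_const[OF init_in_verts])
  have W: "\<bar>W n - \<nu> * real n\<bar> \<le> 2 * B'" for n
    using second_moment_centred[OF m g' B' init_in_verts, of n] B'[OF init_in_verts]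
    unfolding W_def by linarith
  obtain d where V: "eventually (\<lambda>n. \<bar>V n - v * real n\<bar> \<le> d) sequentially"
    using assms by (auto simp: bigo_def expectation_random_path V_def K_def)

  have rate_zero: "x = 0" if "eventually (\<lambda>n. \<bar>x * real n\<bar> \<le> b) sequentially" for x b :: real
  proof (rule ccontr)
    assume "x \<noteq> 0"
    then have "filterlim (\<lambda>n. \<bar>x\<bar> * real n) at_top sequentially"
      by (intro filterlim_tendsto_pos_mult_at_top[OF tendsto_const _ filterlim_real_sequentially]) simp
    then have "eventually (\<lambda>n. b < \<bar>x\<bar> * real n) sequentially"
      by (auto simp: filterlim_at_top_dense)
    with that have "eventually (\<lambda>n. False) sequentially"
      by eventually_elim (simp add: abs_mult)
    then show False by simp
  qed
  have "v = 0 \<longleftrightarrow> \<nu> = 0"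
  proof
    assume "v = 0"
    then have "eventually (\<lambda>n. \<bar>\<nu> * real n\<bar> \<le> 2 * d + c + 2 * B') sequentially"
      using V
    proof (elim eventually_mono)
      fix n assume "\<bar>V n - v * real n\<bar> \<le> d"
      then have "V n \<le> d" using \<open>v = 0\<close> by simp
      then show "\<bar>\<nu> * real n\<bar> \<le> 2 * d + c + 2 * B'"
        using W[of n] W_le[of n] nonneg[of n] by linarith
    qed
    then show "\<nu> = 0" by (rule rate_zero)
  next
    assume "\<nu> = 0"
    have "eventually (\<lambda>n. \<bar>v * real n\<bar> \<le> d + (4 * B' + c)) sequentially"
      using V
    proof (elim eventually_mono)
      fix n assume V: "\<bar>V n - v * real n\<bar> \<le> d"
      have "W n \<le> 2 * B'" using W[of n] \<open>\<nu> = 0\<close> by simp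
      then show "\<bar>v * real n\<bar> \<le> d + (4 * B' + c)"
        using V V_le[of n] nonneg[of n] by linarith
    qed
    then show "v = 0" by (rule rate_zero)
  qed
  also have "\<nu> = 0 \<longleftrightarrow> (\<forall>e\<in>arcs G. tail G e \<in> final_verts \<longrightarrow> m e = 0)"
    by (rule second_moment_rate_eq_0_iff[OF g'])
  finally have v_iff: "v = 0 \<longleftrightarrow> (\<forall>e\<in>arcs G. tail G e \<in> final_verts \<longrightarrow> m e = 0)" .

  show thesis
  proof
    show "(\<lambda>n. measure_pmf.expectation (random_path G p init n) (output_sum k) - \<mu> * real n) \<in> O(\<lambda>_. 1)"
      using K by (intro bigoI[of _ "2 * B"]) (simp add: expectation_random_path K_def)
    show "a = \<mu> \<and> v = 0"
      if "\<And>e. e \<in> arcs G \<Longrightarrow> tail G e \<in> final_verts \<Longrightarrow> k e - a = drift h e" for a h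
      using final_potential_unique[OF g that] v_iff by (simp add: m_def)
    assume "v = 0"
    then show "\<exists>h. \<forall>e\<in>arcs G. tail G e \<in> final_verts \<longrightarrow> k e - \<mu> = drift h e"
      using v_iff by (intro exI[of _ "\<lambda>u. - g u"]) (auto simp: m_def algebra_simps)
  qed
qed

section \<open>Quasi-determinism\<close>

lemma quasi_deterministic_if_potential:
  assumes "\<And>e. e \<in> arcs G \<Longrightarrow> k e - a = drift h e"
  shows "quasi_deterministic (random_path G p init) (output_sum k) a"
proof -
  obtain B where B: "\<And>u. u \<in> verts G \<Longrightarrow> \<bar>h u\<bar> \<le> B" using bounded_on_verts by blast
  have "\<bar>output_sum k P - a * real n\<bar> \<le> 2 * B" if "awalk init P t" "length P = n" for n P t
    using awalk_sum_potential[of "\<lambda>e. k e - a" h, OF assms that(1)] that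
      B[of t] B[OF init_in_verts] awalk_last_in_verts[OF that(1)]
    by (simp add: output_sum_shift)
  then show ?thesis
    unfolding quasi_deterministic_def set_pmf_random_path by blast
qed

text \<open>After a walk from \<open>init\<close> to \<open>u\<close>, each round along
  \<open>C\<close> changes the deviation from \<open>a\<close> times the length by the same amount
  \<open>x\<close>. Arbitrarily many rounds keep it bounded only if \<open>x = 0\<close>.\<close>

lemma closed_walk_sum_if_quasi_deterministic:
  assumes "quasi_deterministic (random_path G p init) (output_sum k) a" and "awalk u C u"
  shows "output_sum k C = a * real (length C)"
proof -
  obtain c where c: "\<And>P t. awalk init P t \<Longrightarrow> \<bar>output_sum k P - a * real (length P)\<bar> \<le> c"
    using assms(1) unfolding quasi_deterministic_def set_pmf_random_path by blast
  define x where "x = output_sum k C - a * real (length C)"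
  obtain P where P: "awalk init P u"
    using accessible[of u] assms(2) by (auto simp: reachable_awalk)
  define y where "y = output_sum k P - a * real (length P)"
  have iterate: "\<exists>Q. awalk init Q u \<and> output_sum k Q - a * real (length Q) = y + real n * x" for n
  proof (induction n)
    case 0
    then show ?case using P by (auto simp: y_def)
  next
    case (Suc n)
    then obtain Q where "awalk init Q u" "output_sum k Q - a * real (length Q) = y + real n * x"
      by blast
    then show ?case
      using awalk_appendI[of init Q u C u] assms(2)
      by (intro exI[of _ "Q @ C"]) (auto simp: x_def algebra_simps)
  qed
  have bound: "real n * \<bar>x\<bar> \<le> c + \<bar>y\<bar>" for n
  proof -
    have "\<bar>y + real n * x\<bar> \<le> c"
      using iterate[of n] c by metis
    then have "\<bar>real n * x\<bar> \<le> c + \<bar>y\<bar>" by linarith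
    then show ?thesis by (simp add: abs_mult)
  qed
  have "x = 0"
  proof (rule ccontr)
    assume "x \<noteq> 0"
    then obtain n where "c + \<bar>y\<bar> < real n * \<bar>x\<bar>"
      using reals_Archimedean3[of "\<bar>x\<bar>"] by auto
    then show False using bound[of n] by simp
  qed
  then show ?thesis by (simp add: x_def)
qed

end

section \<open>The equivalences\<close>

theorem theorem3p2:
  fixes G :: "('a, 'b) pre_digraph" and p :: "'b \<Rightarrow> real" and init :: 'a
    and k :: "'b \<Rightarrow> real" and v :: real
  assumes "finite_markov_chain G p init"
    and "finally_connected G"
    and "finally_aperiodic G"
    and "(\<lambda>n. measure_pmf.variance (random_path G p init n) (output_sum k) - v * real n)
           \<in> O(\<lambda>_. 1)"
  shows
    "(v = 0 \<longleftrightarrow>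
        (\<exists>s \<in> verts (final_component G). \<exists>a.
           \<forall>C \<in> closed_walks_visiting_once (final_component G) s.
             output_sum k C = a * real (length C))) \<and>
     (v = 0 \<longleftrightarrow>
        (\<exists>a. \<forall>C. pre_digraph.cycle (final_component G) C \<longrightarrow>
             output_sum k C = a * real (length C))) \<and>
     (\<forall>a. (\<exists>s \<in> verts (final_component G).
             \<forall>C \<in> closed_walks_visiting_once (final_component G) s.
               output_sum k C = a * real (length C)) \<or>
          (\<forall>C. pre_digraph.cycle (final_component G) C \<longrightarrow>
               output_sum k C = a * real (length C)) \<longrightarrow>
          (\<lambda>n. measure_pmf.expectation (random_path G p init n) (output_sum k) - a * real n)
             \<in> O(\<lambda>_. 1) \<and>
          (\<forall>s \<in> verts (final_component G).
             \<forall>C \<in> closed_walks_visiting_once (final_component G) s.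
               output_sum k C = a * real (length C))) \<and>
     (strongly_connected G \<longrightarrow>
        (v = 0 \<longleftrightarrow> (\<exists>a. quasi_deterministic (random_path G p init) (output_sum k) a)) \<and>
        (\<forall>a. quasi_deterministic (random_path G p init) (output_sum k) a \<longleftrightarrow>
             (\<forall>C. pre_digraph.cycle (final_component G) C \<longrightarrow>
               output_sum k C = a * real (length C))))"
proof -
  interpret finally_connected_chain G p init
    using assms(1,2) by (simp add: finally_connected_chain_def finally_connected_chain_axioms_def)
  interpret H: wf_digraph "final_component G" by (rule wf_final_component)
  let ?H = "final_component G"
  \<comment> \<open>Each of (b), (c) and (d) is compared with this condition for a fixed
    \<open>a\<close>, which also shows that they share the same constant and that (b) does not
    depend on the choice of \<open>s\<close>.\<close>
  define potential where
    "potential a \<longleftrightarrow> (\<exists>h :: 'a \<Rightarrow> real. \<forall>e\<in>arcs ?H. k e - a = h (head ?H e) - h (tail ?H e))" for a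
  note conn = strongly_connected_final_component
  have ends: "head ?H = head G" "tail ?H = tail G"
    by (simp_all add: final_component_eq)
  have closed: "output_sum k C = a * real (length C)" if "potential a" "H.awalk u C u" for a u C
    using that H.closed_walk_sum_if_potential[of k a _ u C] unfolding potential_def by blast
  have cycles_iff: "(\<forall>C. H.cycle C \<longrightarrow> output_sum k C = a * real (length C)) \<longleftrightarrow> potential a" for a
  proof
    assume "\<forall>C. H.cycle C \<longrightarrow> output_sum k C = a * real (length C)"
    then show "potential a"
      using H.potential_if_cycles[OF conn, of k a] unfolding potential_def by metis
  next
    assume "potential a"
    then show "\<forall>C. H.cycle C \<longrightarrow> output_sum k C = a * real (length C)"
      unfolding H.cycle_def using closed by blast
  qed
  have once_iff: "(\<forall>C\<in>closed_walks_visiting_once ?H s. output_sum k C = a * real (length C)) \<longleftrightarrow> potential a"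
    if "s \<in> verts ?H" for a s
  proof
    assume "\<forall>C\<in>closed_walks_visiting_once ?H s. output_sum k C = a * real (length C)"
    then show "potential a"
      using H.potential_if_visiting_once[OF conn that, of k a] unfolding potential_def by metis
  next
    assume "potential a"
    then show "\<forall>C\<in>closed_walks_visiting_once ?H s. output_sum k C = a * real (length C)"
      unfolding closed_walks_visiting_once_def H.closed_w_def using closed by blast
  qed
  have nonempty: "\<exists>s. s \<in> verts ?H"
    using final_verts_nonempty by (auto simp: verts_final_component)
  obtain \<mu> where mean:
      "(\<lambda>n. measure_pmf.expectation (random_path G p init n) (output_sum k) - \<mu> * real n) \<in> O(\<lambda>_. 1)"
    and unique: "\<And>a h. (\<And>e. e \<in> arcs G \<Longrightarrow> tail G e \<in> final_verts \<Longrightarrow> k e - a = drift h e)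
           \<Longrightarrow> a = \<mu> \<and> v = 0"
    and exists: "v = 0 \<Longrightarrow>
      \<exists>h. \<forall>e\<in>arcs G. tail G e \<in> final_verts \<longrightarrow> k e - \<mu> = drift h e"
    using output_rate[OF assms(4)] by blast
  \<comment> \<open>Any admissible \<open>a\<close> is the rate \<mu> of the mean, which gives the
    claim on the expectation.\<close>
  have potentialD: "a = \<mu> \<and> v = 0" if "potential a" for a
    using that unique unfolding potential_def arcs_final_component ends by blast
  have "potential \<mu>" if "v = 0"
    using exists[OF that] unfolding potential_def arcs_final_component ends by blast
  then have v_iff: "v = 0 \<longleftrightarrow> (\<exists>a. potential a)"
    using potentialD by blast
  have qd_iff: "quasi_deterministic (random_path G p init) (output_sum k) a \<longleftrightarrow> potential a"
    if "strongly_connected G" for a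
  proof
    assume "quasi_deterministic (random_path G p init) (output_sum k) a"
    then show "potential a"
      using closed_walk_sum_if_quasi_deterministic
      unfolding cycles_iff[symmetric] final_component_if_strongly_connected[OF that] cycle_def
      by blast
  next
    assume "potential a"
    then show "quasi_deterministic (random_path G p init) (output_sum k) a"
      using quasi_deterministic_if_potential
      unfolding potential_def final_component_if_strongly_connected[OF that] by blast
  qed
  have once_ex: "(\<exists>s\<in>verts ?H. \<exists>a. \<forall>C\<in>closed_walks_visiting_once ?H s.
      output_sum k C = a * real (length C)) \<longleftrightarrow> (\<exists>a. potential a)"
    using once_iff nonempty by blast
  have once_a: "(\<exists>s\<in>verts ?H. \<forall>C\<in>closed_walks_visiting_once ?H s.
      output_sum k C = a * real (length C)) \<longleftrightarrow> potential a" for a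
    using once_iff nonempty by blast
  show ?thesis
    unfolding cycles_iff once_ex once_a
    using v_iff qd_iff potentialD mean once_iff by blast
qed

end
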